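(* Let $F$ be a continuous function with bounded variation on the segment $\left[\frac12,1\right]$. Then $$\sum_{k=2^{n-1}}^{2^n-1}(-1)^k\int_{\xi_{k,n}}^{\xi_{k+1,n}}F(x)\,\mathrm{d}x=O(n^{-1}),\qquad n\to\infty,$$ where $0=\xi_{0,n}<\xi_{1,n}<\dots<\xi_{2^n,n}=1$ are the elements of the $n$-th Stern-Brocot sequence $F_n$ in increasing order (the implied constant may depend on $F$).
   Context: Stern-Brocot sequences: $F_0=\{0/1,1/1\}$. If $F_n$ is written in increasing order as $0=\xi_{0,n}<\xi_{1,n}<\dots<\xi_{2^n,n}=1$ with $\xi_{j,n}=p_{j,n}/q_{j,n}$ in lowest terms, then $F_{n+1}=F_n\cup W_{n+1}$, where $W_{n+1}=\left\{\frac{p_{j,n}+p_{j+1,n}}{q_{j,n}+q_{j+1,n}}: j=0,\dots,2^n-1\right\}$. Thus $|F_n|=2^n+1$, and $\xi_{2^{n-1},n}=\frac12$ for $n\ge1$. (The sequence $F_n$ should not be confused with the function $F$.) *)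

theory Defs
  imports "HOL-Analysis.Analysis"
begin

(* quotient_of yields the lowest-terms representation with positive denominator. *)
definition mediant :: "rat \<Rightarrow> rat \<Rightarrow> rat" where
  "mediant x y =
     (let (p, q) = quotient_of x; (p', q') = quotient_of y in Fract (p + p') (q + q'))"

primrec stern_brocot :: "nat \<Rightarrow> rat set" where
  "stern_brocot 0 = {0, 1}"
| "stern_brocot (Suc n) =
     (let \<xi> = (\<lambda>j. sorted_list_of_set (stern_brocot n) ! j)
      in stern_brocot n \<union> {mediant (\<xi> j) (\<xi> (j + 1)) | j. j < 2 ^ n})"

(* The j-th element (from 0) of the n-th sequence in increasing order; the set has
   2 ^ n + 1 elements, so this is meaningful for j \<le> 2 ^ n only. *)
definition sb_elem :: "nat \<Rightarrow> nat \<Rightarrow> real" where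
  "sb_elem j n = of_rat (sorted_list_of_set (stern_brocot n) ! j)"

definition bounded_variation_on :: "(real \<Rightarrow> real) \<Rightarrow> real \<Rightarrow> real \<Rightarrow> bool" where
  "bounded_variation_on f a b \<longleftrightarrow>
     (\<exists>V. \<forall>(m::nat) (x::nat \<Rightarrow> real).
        x 0 = a \<and> x m = b \<and> (\<forall>i<m. x i < x (Suc i)) \<longrightarrow>
        (\<Sum>i<m. \<bar>f (x (Suc i)) - f (x i)\<bar>) \<le> V)"

end

theory Submission
  imports Defs
begin

text \<open>
  Why the sum is \<open>O(1/n)\<close>. Since \<open>F\<close> is continuous, its integral over a Stern-Brocot interval is the
  length of the interval times a value of \<open>F\<close> inside it. Abel summation and the bounded variation of
  \<open>F\<close> then reduce the theorem to a uniform bound: all partial sums of the alternating series of the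
  interval lengths in \<open>[1/2, 1]\<close> are at most \<open>1/(n + 1)\<close> in absolute value, the length of the longest
  of these intervals, which is the last one.

  Two neighbours whose denominators are \<open>a\<close> and \<open>b\<close> are \<open>1/(a * b)\<close> apart, and taking mediants inserts
  \<open>a + b\<close> between \<open>a\<close> and \<open>b\<close>. So everything can be phrased in terms of denominators. Let
  \<open>S\<^sub>m(a, b)\<close> be the alternating sum of the \<open>2^m\<close> lengths into which the interval with denominators
  \<open>a, b\<close> is cut after \<open>m\<close> steps. For \<open>m \<ge> 1\<close> it is antisymmetric, because reversing an even number
  of pieces changes every sign, and hence
  \<open>S\<^sub>m\<^sub>+\<^sub>1(a, b) = S\<^sub>m(a, a + b) - S\<^sub>m(b, a + b)\<close>.
  The operator on the right-hand side preserves the class of functions that are homogeneous of degree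
  \<open>-2\<close>, vanish on the diagonal and are decreasing in the smaller argument
  (\<open>descending_children\<close>); such functions are nonnegative for \<open>a \<le> b\<close>. Not only \<open>S\<^sub>m\<close> belongs to this
  class, but also the difference of the two extreme pieces minus \<open>S\<^sub>m\<close> (\<open>descending_end_excess\<close>).

  These two sign statements are just what an induction over \<open>m\<close> needs to show that for \<open>a \<le> b\<close> all
  partial sums lie between \<open>0\<close> and the length of the first piece (\<open>alt_sum_bounds\<close>); reversal gives the
  corresponding bound for \<open>a \<ge> b\<close>. The interval \<open>[1/2, 1]\<close> is the case \<open>a = 2\<close>, \<open>b = 1\<close>.
\<close>

section \<open>Repeated insertion of sums between neighbours\<close>

text \<open>
  The entry with index \<open>k\<close> of the row that arises from \<open>a, b\<close> by inserting \<open>m\<close> times, between any two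
  neighbours, their sum. Numerators and denominators of the Stern-Brocot sequence are both instances.
  The last level of insertion is peeled off, as in the construction of the sequence; splitting off the
  first one instead is \<open>stern_split\<close>.
\<close>

fun stern :: "nat \<Rightarrow> 'a::ab_semigroup_add \<Rightarrow> 'a \<Rightarrow> nat \<Rightarrow> 'a" where
  "stern 0 a b k = (if k = 0 then a else b)"
| "stern (Suc m) a b k =
     (if even k then stern m a b (k div 2)
      else stern m a b (k div 2) + stern m a b (k div 2 + 1))"

lemma stern_first [simp]: "stern m a b 0 = a"
  by (induction m) auto

lemma stern_last [simp]: "stern m a b (2 ^ m) = b"
  by (induction m) auto

lemma stern_split:
  "k \<le> 2 ^ m \<Longrightarrow> stern (Suc m) a b k = stern m a (a + b) k"
  "k \<le> 2 ^ m \<Longrightarrow> stern (Suc m) a b (2 ^ m + k) = stern m (a + b) b k"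
proof (induction m arbitrary: k)
  case 0
  { case 1 then show ?case by (cases k) auto }
  { case 2 then show ?case by (cases k) auto }
next
  case (Suc m)
  { case 1
    show ?case
    proof (cases "even k")
      case True
      then have "k div 2 \<le> 2 ^ m" using 1 by auto
      with True show ?thesis using Suc.IH(1)[of "k div 2"] by (simp del: stern.simps add: stern.simps(2)[of "Suc m"] stern.simps(2)[of m a "a + b"])
    next
      case False
      then have "k div 2 \<le> 2 ^ m" "k div 2 + 1 \<le> 2 ^ m" using 1 by (auto elim!: oddE)
      with False show ?thesis using Suc.IH(1)[of "k div 2"] Suc.IH(1)[of "k div 2 + 1"]
        by (simp del: stern.simps add: stern.simps(2)[of "Suc m"] stern.simps(2)[of m a "a + b"])
    qed }
  { case 2
    have h: "(2 ^ Suc m + k) div 2 = 2 ^ m + k div 2" by simp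
    show ?case
    proof (cases "even k")
      case True
      then have "k div 2 \<le> 2 ^ m" using 2 by auto
      with True h show ?thesis using Suc.IH(2)[of "k div 2"]
        by (simp del: stern.simps add: stern.simps(2)[of "Suc m"] stern.simps(2)[of m "a + b" b])
    next
      case False
      then have "k div 2 \<le> 2 ^ m" "k div 2 + 1 \<le> 2 ^ m" using 2 by (auto elim!: oddE)
      with False h show ?thesis using Suc.IH(2)[of "k div 2"] Suc.IH(2)[of "k div 2 + 1"]
        by (simp del: stern.simps add: stern.simps(2)[of "Suc m"] stern.simps(2)[of m "a + b" b])
    qed }
qed

lemma stern_rev: "k \<le> 2 ^ m \<Longrightarrow> stern m a b (2 ^ m - k) = stern m b a k"
proof (induction m arbitrary: k)
  case 0
  then show ?case by (cases k) auto
next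
  case (Suc m)
  show ?case
  proof (cases "even k")
    case True
    then obtain i where "k = 2 * i" by blast
    with Suc show ?thesis by (simp flip: right_diff_distrib')
  next
    case False
    then obtain i where k: "k = 2 * i + 1" using oddE by blast
    with Suc.prems have i: "i + 1 \<le> 2 ^ m" by auto
    then obtain d where d: "2 ^ m = i + 1 + d" using le_Suc_ex by blast
    then have h: "2 ^ Suc m - k = 2 * d + 1" "2 ^ m - i = d + 1" "2 ^ m - (i + 1) = d" using k by auto
    show ?thesis unfolding h(1) using Suc.IH[of i] Suc.IH[of "i + 1"] i h(2,3) k
      by (simp add: add.commute)
  qed
qed

lemma stern_pos:
  fixes a b :: "'a::linordered_semidom"
  shows "0 < a \<Longrightarrow> 0 < b \<Longrightarrow> 0 < stern m a b k"
  by (induction m arbitrary: k) (auto intro: add_pos_pos)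

lemma of_int_stern: "of_int (stern m a b k) = (stern m (of_int a) (of_int b) k :: 'a::ring_1)"
  by (induction m arbitrary: k) auto

text \<open>An insertion adds one column of the determinant of two neighbouring columns to the other one,
  so the determinant never changes.\<close>

lemma stern_det:
  fixes a b c d :: "'a::comm_ring"
  shows "k < 2 ^ m \<Longrightarrow>
    stern m c d (Suc k) * stern m a b k - stern m c d k * stern m a b (Suc k) = d * a - c * b"
proof (induction m arbitrary: k)
  case 0
  then show ?case by simp
next
  case (Suc m)
  have "k div 2 < 2 ^ m" using Suc.prems by auto
  from Suc.IH[OF this] show ?case
    by (cases "even k") (auto elim!: evenE oddE simp: algebra_simps)
qed

section \<open>Alternating sums of interval lengths\<close>

definition alt_sum :: "nat \<Rightarrow> real \<Rightarrow> real \<Rightarrow> nat \<Rightarrow> real" where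
  "alt_sum m a b k = (\<Sum>j<k. (-1) ^ j / (stern m a b j * stern m a b (Suc j)))"

abbreviation alt_total :: "nat \<Rightarrow> real \<Rightarrow> real \<Rightarrow> real" where
  "alt_total m a b \<equiv> alt_sum m a b (2 ^ m)"

text \<open>The first mediant cuts the row into two halves. The right half starts at the even index \<open>2 ^ m\<close> as soon
  as \<open>m > 0\<close>, so that its signs start again with a plus.\<close>

lemma alt_sum_split:
  assumes "k \<le> 2 ^ m"
  shows alt_sum_left: "alt_sum (Suc m) a b k = alt_sum m a (a + b) k"
    and alt_sum_right: "0 < m \<Longrightarrow>
      alt_sum (Suc m) a b (2 ^ m + k) = alt_total m a (a + b) + alt_sum m (a + b) b k"
proof -
  have L: "alt_sum (Suc m) a b i = alt_sum m a (a + b) i" if "i \<le> 2 ^ m" for i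
    unfolding alt_sum_def using that
    by (intro sum.cong refl) (simp del: stern.simps add: stern_split(1))
  show "alt_sum (Suc m) a b k = alt_sum m a (a + b) k" using L assms by blast
  assume "0 < m"
  then have e: "even (2 ^ m :: nat)" by simp
  have "alt_sum (Suc m) a b (2 ^ m + k) = alt_sum (Suc m) a b (2 ^ m)
    + (\<Sum>j<k. (-1) ^ (2 ^ m + j) / (stern (Suc m) a b (2 ^ m + j) * stern (Suc m) a b (Suc (2 ^ m + j))))"
    unfolding alt_sum_def by (induction k) auto
  also have "(\<Sum>j<k. (-1) ^ (2 ^ m + j) / (stern (Suc m) a b (2 ^ m + j) * stern (Suc m) a b (Suc (2 ^ m + j))))
    = alt_sum m (a + b) b k"
    unfolding alt_sum_def using assms e
    by (intro sum.cong refl)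
      (simp del: stern.simps add: stern_split(2) power_add flip: add_Suc_right)
  finally show "alt_sum (Suc m) a b (2 ^ m + k) = alt_total m a (a + b) + alt_sum m (a + b) b k"
    using L by simp
qed

text \<open>Reading the row backwards reverses all signs, the number of intervals being even. So a sum over the
  last intervals of the row from \<open>a\<close> to \<open>b\<close> is minus an initial sum of the row from \<open>b\<close> to \<open>a\<close>.\<close>

lemma alt_sum_rev:
  assumes "k \<le> 2 ^ m" "0 < m"
  shows "alt_sum m a b k = alt_total m a b + alt_sum m b a (2 ^ m - k)"
  using assms(1)
proof (induction rule: inc_induct)
  case base
  then show ?case by (simp add: alt_sum_def)
next
  case (step k)
  let ?i = "2 ^ m - Suc k"
  have i: "2 ^ m - k = Suc ?i" using step by simp
  have e: "even (2 ^ m :: nat)" using assms(2) by simp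
  have "(-1) ^ ?i = (- ((-1) ^ k) :: real)"
    using e step.hyps by (simp add: minus_one_power_iff)
  moreover have "stern m b a ?i = stern m a b (Suc k)" "stern m b a (Suc ?i) = stern m a b k"
    using step stern_rev[of "Suc k" m b a] stern_rev[of k m b a] i by auto
  moreover have "alt_sum m b a (Suc ?i) = alt_sum m b a ?i + (-1) ^ ?i / (stern m b a ?i * stern m b a (Suc ?i))"
    by (simp add: alt_sum_def)
  moreover have "alt_sum m a b (Suc k) = alt_sum m a b k + (-1) ^ k / (stern m a b k * stern m a b (Suc k))"
    by (simp add: alt_sum_def)
  ultimately show ?case using step.IH unfolding i by (simp add: mult.commute)
qed

lemma alt_total_swap: "0 < m \<Longrightarrow> alt_total m b a = - alt_total m a b"
  using alt_sum_rev[of 0 m a b] by (simp add: alt_sum_def)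

lemma alt_total_rec:
  "0 < m \<Longrightarrow> alt_total (Suc m) a b = alt_total m a (a + b) - alt_total m b (a + b)"
  using alt_sum_right[of "2 ^ m" m a b] alt_total_swap[of m b "a + b"] by (simp add: mult_2)

lemma alt_total_1: "alt_total 1 a b = 1 / (a * (a + b)) - 1 / (b * (a + b))"
  by (simp add: alt_sum_def numeral_2_eq_2 mult.commute)

section \<open>A class of functions preserved by the mediant recursion\<close>

text \<open>By homogeneity such a function is determined by \<open>g(x) = f(x, 1)\<close> for \<open>0 < x \<le> 1\<close>, where \<open>g\<close> is
  decreasing with \<open>g(1) = 0\<close>. The form with two variables fits the recursion for \<open>alt_total\<close>.\<close>

definition descending :: "(real \<Rightarrow> real \<Rightarrow> real) \<Rightarrow> bool" where
  "descending f \<longleftrightarrow>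
     (\<forall>r x s. 0 < r \<longrightarrow> 0 < x \<longrightarrow> 0 < s \<longrightarrow> f (r * x) (r * s) = f x s / r\<^sup>2) \<and>
     (\<forall>s>0. f s s = 0) \<and>
     (\<forall>x y s. 0 < x \<longrightarrow> x \<le> y \<longrightarrow> y \<le> s \<longrightarrow> f y s \<le> f x s)"

lemma descending_nonneg: "descending f \<Longrightarrow> 0 < x \<Longrightarrow> x \<le> s \<Longrightarrow> 0 \<le> f x s"
  unfolding descending_def by (metis order.refl order_less_le_trans)

lemma descending_zero: "descending (\<lambda>x s. 0)"
  by (simp add: descending_def)

lemma descending_add:
  "descending f \<Longrightarrow> descending g \<Longrightarrow> descending (\<lambda>x s. f x s + g x s)"
  unfolding descending_def by (auto simp: add_divide_distrib intro: add_mono)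

text \<open>In terms of \<open>g(x) = f(x, 1)\<close>, the new function is
  \<open>(g(x / (1 + x)) - g(1 / (1 + x))) / (1 + x)\<^sup>2\<close>. As \<open>x\<close> grows up to \<open>1\<close>, the argument
  \<open>x / (1 + x)\<close> grows and the larger one \<open>1 / (1 + x)\<close> falls, so the difference is nonnegative and
  decreasing; the factor \<open>1 / (1 + x)\<^sup>2\<close> is positive and decreasing.\<close>

lemma descending_children:
  assumes f: "descending f"
  shows "descending (\<lambda>x s. f x (x + s) - f s (x + s))"
proof -
  have hom: "f (r * x) (r * s) = f x s / r\<^sup>2" if "0 < r" "0 < x" "0 < s" for r x s
    using f that unfolding descending_def by blast
  have anti: "f y s \<le> f x s" if "0 < x" "x \<le> y" "y \<le> s" for x y s
    using f that unfolding descending_def by blast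
  have "f y (y + s) - f s (y + s) \<le> f x (x + s) - f s (x + s)"
    if x: "0 < x" and xy: "x \<le> y" and ys: "y \<le> s" for x y s
  proof -
    \<comment> \<open>Rescaling by r makes the larger argument of both functions equal to \<open>x + s\<close>.\<close>
    define r where "r = (x + s) / (y + s)"
    have r: "0 < r" "r \<le> 1" "r * (y + s) = x + s" using that by (auto simp: r_def)
    have "x \<le> r * y"
    proof -
      have "x * (y + s) \<le> (x + s) * y"
        using mult_right_mono[OF xy, of s] that by (simp add: algebra_simps)
      then show ?thesis using that by (simp add: r_def field_simps)
    qed
    then have 1: "f (r * y) (x + s) \<le> f x (x + s)"
      using that r mult_left_le_one_le[of y r] mult_left_mono[of y "y + s" r]
      by (intro anti) auto
    have 2: "f s (x + s) \<le> f (r * s) (x + s)"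
      using that r mult_left_le_one_le[of s r] by (intro anti) auto
    have 0: "0 \<le> f y (y + s) - f s (y + s)"
      using anti[of y s "y + s"] that by auto
    have "f (r * y) (x + s) = f y (y + s) / r\<^sup>2" "f (r * s) (x + s) = f s (y + s) / r\<^sup>2"
      using hom[OF r(1), of _ "y + s"] that unfolding r(3) by auto
    then have "f (r * y) (x + s) - f (r * s) (x + s) = (f y (y + s) - f s (y + s)) / r\<^sup>2"
      by (simp add: diff_divide_distrib)
    moreover have "f y (y + s) - f s (y + s) \<le> (f y (y + s) - f s (y + s)) / r\<^sup>2"
    proof -
      have "r\<^sup>2 \<le> 1" "0 < r\<^sup>2" using r by (auto simp: power_le_one)
      then show ?thesis using 0 by (simp add: le_divide_eq mult_left_le)
    qed
    ultimately show ?thesis using 1 2 by linarith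
  qed
  moreover have "f (r * x) (r * x + r * s) - f (r * s) (r * x + r * s)
      = (f x (x + s) - f s (x + s)) / r\<^sup>2" if "0 < r" "0 < x" "0 < s" for r x s
    using hom[OF that(1,2), of "x + s"] hom[OF that(1,3), of "x + s"] that
    by (simp add: distrib_left diff_divide_distrib)
  ultimately show ?thesis unfolding descending_def by auto
qed

text \<open>With \<open>c = x + s\<close>, this is the difference of the lengths of the two pieces that meet at the mediant of
  \<open>x\<close> and \<open>s\<close>, when each half has its extreme pieces obtained by moving \<open>t\<close> mediant steps towards \<open>c\<close>. It
  is the inhomogeneous term in the recursion for \<open>descending_end_excess\<close>, and for \<open>t = 0\<close> it is the
  alternating sum \<open>alt_total 1\<close>.\<close>

lemma descending_gap:
  assumes t: "0 \<le> t"
  shows "descending (\<lambda>x s. 1 / ((x + s) * (t * (x + s) + x)) - 1 / ((x + s) * (t * (x + s) + s)))"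
    (is "descending ?g")
proof -
  have g: "?g x s = (s - x) / ((x + s) * (t * (x + s) + x) * (t * (x + s) + s))"
    if "0 < x" "0 < s" for x s
  proof -
    have "0 < t * (x + s) + x" "0 < t * (x + s) + s"
      using that t by (auto intro!: add_nonneg_pos mult_nonneg_nonneg)
    then show ?thesis using that by (simp add: divide_simps)
  qed
  have "?g y s \<le> ?g x s" if "0 < x" "x \<le> y" "y \<le> s" for x y s
  proof -
    have "0 < t * (x + s) + x" "0 < t * (x + s) + s"
      using that t by (auto intro!: add_nonneg_pos mult_nonneg_nonneg)
    moreover have "t * (x + s) \<le> t * (y + s)" using t that by (intro mult_left_mono) auto
    ultimately show ?thesis using that by (subst (1 2) g) (auto intro!: frac_le mult_mono)
  qed
  moreover have "?g (r * x) (r * s) = ?g x s / r\<^sup>2" if "0 < r" for r x s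
  proof -
    have *: "(r * x + r * s) * (t * (r * x + r * s) + r * z) = ((x + s) * (t * (x + s) + z)) * r\<^sup>2" for z
      by (simp add: algebra_simps power2_eq_square)
    show ?thesis unfolding * by (simp add: diff_divide_distrib)
  qed
  ultimately show ?thesis unfolding descending_def by auto
qed

lemma descending_alt_total: "descending (alt_total (Suc m))"
proof (induction m)
  case 0
  have "alt_total (Suc 0) = (\<lambda>x s. 1 / ((x + s) * (0 * (x + s) + x)) - 1 / ((x + s) * (0 * (x + s) + s)))"
    using alt_total_1 by (intro ext) (simp add: mult.commute)
  then show ?case using descending_gap[of 0] by simp
next
  case (Suc m)
  have "alt_total (Suc (Suc m)) = (\<lambda>x s. alt_total (Suc m) x (x + s) - alt_total (Suc m) s (x + s))"
    by (intro ext alt_total_rec) simp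
  then show ?case using descending_children[OF Suc] by simp
qed

section \<open>Bounds for the partial alternating sums\<close>

text \<open>The length of the first of the \<open>2 ^ m\<close> pieces of the row from \<open>a\<close> to \<open>b\<close>; by symmetry,
  \<open>end_len m b a\<close> is the length of the last one.\<close>

definition end_len :: "nat \<Rightarrow> real \<Rightarrow> real \<Rightarrow> real" where
  "end_len m a b = 1 / (a * (real m * a + b))"

lemma end_len_Suc: "end_len m a (a + b) = end_len (Suc m) a b"
  by (simp add: end_len_def algebra_simps)

text \<open>For \<open>0 < a \<le> b\<close> this makes the expression nonnegative, that is, the alternating sum over the inner
  pieces alone is not positive. The recursion for \<open>alt_total\<close> carries over to the expression, up to
  the two pieces at the first mediant, which become inner pieces; they contribute a term of the form
  treated in \<open>descending_gap\<close>.\<close>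

lemma descending_end_excess:
  "descending (\<lambda>a b. end_len (Suc m) a b - end_len (Suc m) b a - alt_total (Suc m) a b)"
proof (induction m)
  case 0
  have "(\<lambda>a b. end_len (Suc 0) a b - end_len (Suc 0) b a - alt_total (Suc 0) a b) = (\<lambda>a b. 0)"
    using alt_total_1 by (intro ext) (simp add: end_len_def add.commute)
  then show ?case using descending_zero by simp
next
  case (Suc m)
  let ?e = "\<lambda>m a b. end_len (Suc m) a b - end_len (Suc m) b a - alt_total (Suc m) a b"
  let ?t = "real (Suc m)"
  have "?e (Suc m) = (\<lambda>a b. (?e m a (a + b) - ?e m b (a + b)) +
    (1 / ((a + b) * (?t * (a + b) + a)) - 1 / ((a + b) * (?t * (a + b) + b))))"
  proof (intro ext)
    fix a b
    show "?e (Suc m) a b = (?e m a (a + b) - ?e m b (a + b)) +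
    (1 / ((a + b) * (?t * (a + b) + a)) - 1 / ((a + b) * (?t * (a + b) + b)))"
      using end_len_Suc[of "Suc m" a b] end_len_Suc[of "Suc m" b a] alt_total_rec[of "Suc m" a b]
      by (simp only: end_len_def[of _ "a + b"] add.commute[of b a])
  qed
  then show ?case
    using descending_add[OF descending_children[OF Suc] descending_gap[of ?t]] by simp
qed

text \<open>Reversal turns bounds for the partial sums of the row from \<open>b\<close> to \<open>a\<close> into bounds for the row from
  \<open>a\<close> to \<open>b\<close>; both are shifted by the total sum.\<close>

lemma alt_sum_bounds_ge:
  assumes "\<And>k. k \<le> 2 ^ m \<Longrightarrow> 0 \<le> alt_sum m b a k \<and> alt_sum m b a k \<le> end_len m b a"
    and "0 < m" "k \<le> 2 ^ m"
  shows "alt_total m a b \<le> alt_sum m a b k \<and> alt_sum m a b k \<le> alt_total m a b + end_len m b a"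
  using alt_sum_rev[OF assms(3,2), of a b] assms(1)[of "2 ^ m - k"] by simp

text \<open>Let \<open>c = a + b\<close>. In the left half the claim is that for \<open>(a, c)\<close>, with the same first piece. In the
  right half the induction hypothesis is applied to the reversed pair \<open>(b, c)\<close>. It places the partial sums
  between the total sum for \<open>(a, b)\<close> and this total plus the last piece. The total is nonnegative by
  \<open>descending_alt_total\<close>, and adding the last piece to it does not exceed the first piece by
  \<open>descending_end_excess\<close>.\<close>

lemma alt_sum_bounds:
  assumes "0 < a" "a \<le> b" "k \<le> 2 ^ Suc m"
  shows "0 \<le> alt_sum (Suc m) a b k \<and> alt_sum (Suc m) a b k \<le> end_len (Suc m) a b"
  using assms
proof (induction m arbitrary: a b k)
  case 0
  then consider "k = 0" | "k = 1" | "k = 2" by fastforce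
  then show ?case
  proof cases
    case 3
    then show ?thesis
      using descending_nonneg[OF descending_alt_total, of a b 0] alt_total_1[of a b] 0
      by (auto simp: end_len_def)
  qed (use 0 in \<open>auto simp: alt_sum_def end_len_def\<close>)
next
  case (Suc m)
  note pos = Suc.prems(1,2)
  let ?c = "a + b"
  show ?case
  proof (cases "k \<le> 2 ^ Suc m")
    case True
    then show ?thesis
      using Suc.IH[of a ?c k] pos alt_sum_left[OF True, of a b] end_len_Suc[of "Suc m" a b] by simp
  next
    case False
    define i where "i = k - 2 ^ Suc m"
    have k: "k = 2 ^ Suc m + i" "i \<le> 2 ^ Suc m"
      using False Suc.prems(3) by (auto simp: i_def)
    have "alt_total (Suc m) ?c b \<le> alt_sum (Suc m) ?c b i \<and>
      alt_sum (Suc m) ?c b i \<le> alt_total (Suc m) ?c b + end_len (Suc m) b ?c"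
      using pos k(2) by (intro alt_sum_bounds_ge Suc.IH) auto
    moreover have "end_len (Suc m) b ?c = end_len (Suc (Suc m)) b a"
      using end_len_Suc[of "Suc m" b a] by (simp only: add.commute)
    moreover have "alt_sum (Suc (Suc m)) a b k = alt_total (Suc m) a ?c + alt_sum (Suc m) ?c b i"
      unfolding k(1) by (rule alt_sum_right[OF k(2)]) simp
    moreover have "alt_total (Suc (Suc m)) a b = alt_total (Suc m) a ?c + alt_total (Suc m) ?c b"
      using alt_total_rec[of "Suc m" a b] alt_total_swap[of "Suc m" ?c b] by simp
    moreover have "0 \<le> alt_total (Suc (Suc m)) a b"
      using descending_nonneg[OF descending_alt_total] pos by blast
    moreover have "alt_total (Suc (Suc m)) a b \<le> end_len (Suc (Suc m)) a b - end_len (Suc (Suc m)) b a"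
      using descending_nonneg[OF descending_end_excess pos, of "Suc m"] by simp
    ultimately show ?thesis by linarith
  qed
qed

text \<open>For \<open>a \<ge> b\<close> the total sum lies between minus the last piece and \<open>0\<close>, and the partial sums exceed it by
  at most the last piece.\<close>

lemma abs_alt_sum_le:
  assumes "0 < b" "b \<le> a" "k \<le> 2 ^ Suc m"
  shows "\<bar>alt_sum (Suc m) a b k\<bar> \<le> end_len (Suc m) b a"
proof -
  have b: "0 \<le> alt_sum (Suc m) b a i \<and> alt_sum (Suc m) b a i \<le> end_len (Suc m) b a"
    if "i \<le> 2 ^ Suc m" for i
    using alt_sum_bounds[OF assms(1,2) that] .
  show ?thesis
    using alt_sum_bounds_ge[OF b _ assms(3)] b[of "2 ^ Suc m"] alt_total_swap[of "Suc m" a b] by auto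
qed

section \<open>The Stern-Brocot sequence in terms of denominators\<close>

definition sb_rat :: "nat \<Rightarrow> nat \<Rightarrow> rat" where
  "sb_rat n k = Fract (stern n 0 1 k) (stern n 1 1 k)"

lemma sb_rat_eq: "of_rat (sb_rat n k) = (stern n 0 1 k / stern n 1 1 k :: real)"
  by (simp add: sb_rat_def of_rat_rat of_int_stern stern_pos less_imp_neq[symmetric])

text \<open>Mediants are formed from lowest terms. The fractions produced by \<open>stern\<close> are already reduced, because
  neighbours have determinant one.\<close>

lemma quotient_of_sb_rat:
  assumes "k \<le> 2 ^ n"
  shows "quotient_of (sb_rat n k) = (stern n 0 1 k, stern n 1 1 k)"
proof -
  have "coprime (stern n 0 1 k) (stern n 1 (1::int) k)"
  proof (cases "k < 2 ^ n")
    case True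
    have "d dvd 1" if d: "d dvd stern n 0 1 k" "d dvd stern n 1 (1::int) k" for d
    proof -
      have "d dvd stern n 0 1 (Suc k) * stern n 1 1 k - stern n 0 1 k * stern n 1 1 (Suc k)"
        by (rule dvd_diff[OF dvd_mult[OF d(2)] dvd_mult2[OF d(1)]])
      then show ?thesis using stern_det[OF True, of "0::int" 1 1 1] by simp
    qed
    then show ?thesis by (simp add: coprime_def)
  next
    case False
    then show ?thesis using assms by simp
  qed
  then show ?thesis
    using quotient_of_Fract[of "stern n 0 1 k" "stern n 1 1 k"] stern_pos[of "1::int" 1 n k]
    by (simp add: sb_rat_def Rat.normalize_def)
qed

lemma sb_rat_diff:
  assumes "k < 2 ^ n"
  shows "(of_rat (sb_rat n (Suc k)) - of_rat (sb_rat n k) :: real)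
    = 1 / (stern n 1 1 k * stern n 1 1 (Suc k))"
proof -
  have "0 < stern n 1 (1::real) k" "0 < stern n 1 (1::real) (Suc k)" by (simp_all add: stern_pos)
  then show ?thesis using stern_det[OF assms, of "0::real" 1 1 1]
    by (simp add: sb_rat_eq divide_simps)
qed

lemma sb_rat_less: "j < k \<Longrightarrow> k \<le> 2 ^ n \<Longrightarrow> sb_rat n j < sb_rat n k"
proof (induction k)
  case (Suc k)
  have "(0::real) < of_rat (sb_rat n (Suc k)) - of_rat (sb_rat n k)"
    using Suc.prems by (subst sb_rat_diff) (auto simp: stern_pos)
  then have "sb_rat n k < sb_rat n (Suc k)" by (simp add: of_rat_less)
  moreover have "j < k \<Longrightarrow> sb_rat n j < sb_rat n k" using Suc by simp
  ultimately show ?case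
    using Suc.prems(1) order.strict_trans unfolding less_Suc_eq by blast
qed simp

lemma mediant_sb_rat:
  assumes "k < 2 ^ n"
  shows "mediant (sb_rat n k) (sb_rat n (k + 1)) = sb_rat (Suc n) (2 * k + 1)"
proof -
  have "k \<le> 2 ^ n" "k + 1 \<le> 2 ^ n" using assms by auto
  then show ?thesis
    unfolding mediant_def by (subst (1 2) quotient_of_sb_rat) (simp_all add: sb_rat_def)
qed

lemma sorted_list_of_sb_rat:
  "sorted_list_of_set (sb_rat n ` {..2 ^ n}) = map (sb_rat n) [0..<Suc (2 ^ n)]"
proof -
  have "sorted_wrt (<) (map (sb_rat n) [0..<Suc (2 ^ n)])"
    by (auto simp: sorted_wrt_iff_nth_less sb_rat_less simp del: upt_Suc)
  then have "sorted_list_of_set (set (map (sb_rat n) [0..<Suc (2 ^ n)])) = map (sb_rat n) [0..<Suc (2 ^ n)]"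
    using sorted_list_of_set.idem_if_sorted_distinct strict_sorted_iff by blast
  moreover have "set (map (sb_rat n) [0..<Suc (2 ^ n)]) = sb_rat n ` {..2 ^ n}"
    by (simp only: set_map set_upt atLeast0LessThan lessThan_Suc_atMost)
  ultimately show ?thesis by metis
qed

lemma stern_brocot_eq: "stern_brocot n = sb_rat n ` {..2 ^ n}"
proof (induction n)
  case 0
  have "{..1::nat} = {0, 1}" by auto
  then show ?case by (simp add: sb_rat_def rat_number_collapse)
next
  case (Suc n)
  have nth: "sorted_list_of_set (stern_brocot n) ! j = sb_rat n j" if "j \<le> 2 ^ n" for j
    unfolding Suc sorted_list_of_sb_rat using that by (simp del: upt_Suc)
  have "{mediant (sorted_list_of_set (stern_brocot n) ! j) (sorted_list_of_set (stern_brocot n) ! (j + 1)) | j. j < 2 ^ n}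
    = (\<lambda>j. sb_rat (Suc n) (2 * j + 1)) ` {..<2 ^ n}"
    using mediant_sb_rat[of _ n] nth by (auto simp: image_iff) (metis Suc_leI less_imp_le)+
  moreover have "sb_rat n ` {..2 ^ n} = (\<lambda>j. sb_rat (Suc n) (2 * j)) ` {..2 ^ n}"
    by (simp add: sb_rat_def)
  moreover have "{..2 ^ Suc n} = (\<lambda>j. 2 * j) ` {..2 ^ n} \<union> (\<lambda>j. 2 * j + 1) ` {..<2 ^ n :: nat}"
  proof (intro equalityI subsetI)
    fix x :: nat assume x: "x \<in> {..2 ^ Suc n}"
    show "x \<in> (\<lambda>j. 2 * j) ` {..2 ^ n} \<union> (\<lambda>j. 2 * j + 1) ` {..<2 ^ n}"
      using x by (cases "even x") (auto elim!: evenE oddE)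
  qed auto
  ultimately show ?case by (simp only: stern_brocot.simps(2) Let_def image_Un image_image) (simp only: Suc)
qed

lemma sb_elem_eq: "k \<le> 2 ^ n \<Longrightarrow> sb_elem k n = of_rat (sb_rat n k)"
  unfolding sb_elem_def stern_brocot_eq sorted_list_of_sb_rat by (simp del: upt_Suc)

text \<open>The upper half of a row is the row generated by the denominators \<open>2\<close> and \<open>1\<close> of \<open>1/2\<close> and \<open>1/1\<close>.\<close>

lemma sb_elem_upper_half:
  assumes "k < 2 ^ n"
  shows "sb_elem (2 ^ n + Suc k) (Suc n) - sb_elem (2 ^ n + k) (Suc n) =
    1 / (stern n 2 1 k * stern n 2 1 (Suc k))"
  using sb_rat_diff[of "2 ^ n + k" "Suc n"] assms
    stern_split(2)[of k n "1::real" 1] stern_split(2)[of "Suc k" n "1::real" 1]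
  by (simp add: sb_elem_eq del: stern.simps)

section \<open>Alternating integrals of functions of bounded variation\<close>

lemma integral_mean_value:
  fixes F :: "real \<Rightarrow> real"
  assumes "a < b" "continuous_on {a..b} F"
  obtains \<eta> where "a < \<eta>" "\<eta> < b" "integral {a..b} F = (b - a) * F \<eta>"
proof -
  have "((\<lambda>x. integral {a..x} F) has_derivative (\<lambda>h. F x * h)) (at x within {a..b})"
    if "a \<le> x" "x \<le> b" for x
    using integral_has_real_derivative[OF assms(2), of x] that
    by (simp add: has_field_derivative_def)
  from mvt_simple[OF assms(1) this]
  obtain \<eta> where "\<eta> \<in> {a<..<b}" "integral {a..b} F - integral {a..a} F = F \<eta> * (b - a)"
    by blast
  then show thesis by (intro that[of \<eta>]) (auto simp: mult.commute)
qed

lemma abs_abel_sum_le: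
  fixes w f :: "nat \<Rightarrow> real"
  assumes "\<And>k. k \<le> Suc M \<Longrightarrow> \<bar>\<Sum>j<k. w j\<bar> \<le> B"
  shows "\<bar>\<Sum>j<Suc M. w j * f j\<bar> \<le> B * (\<bar>f M\<bar> + (\<Sum>j<M. \<bar>f (Suc j) - f j\<bar>))"
proof -
  have "(\<Sum>j<Suc M. w j * f j) =
      (\<Sum>j<Suc M. w j) * f M - (\<Sum>j<M. (\<Sum>i<Suc j. w i) * (f (Suc j) - f j))"
    by (induction M) (auto simp: algebra_simps)
  also have "\<bar>\<dots>\<bar> \<le> \<bar>\<Sum>j<Suc M. w j\<bar> * \<bar>f M\<bar> + (\<Sum>j<M. \<bar>\<Sum>i<Suc j. w i\<bar> * \<bar>f (Suc j) - f j\<bar>)"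
    by (intro order_trans[OF abs_triangle_ineq4] add_mono order_trans[OF sum_abs])
      (simp_all only: abs_mult order_refl)
  also have "\<dots> \<le> B * \<bar>f M\<bar> + (\<Sum>j<M. B * \<bar>f (Suc j) - f j\<bar>)"
    by (intro add_mono sum_mono mult_right_mono assms) auto
  finally show ?thesis by (simp add: distrib_left sum_distrib_left)
qed

text \<open>The points at which \<open>F\<close> takes its mean value on the successive intervals are increasing, so the
  variation of \<open>F\<close> controls the differences that occur in Abel summation.\<close>

lemma abs_alternating_integral_le:
  fixes F :: "real \<Rightarrow> real" and x :: "nat \<Rightarrow> real"
  assumes cont: "continuous_on {a..b} F"
    and V: "\<And>m y. y 0 = a \<Longrightarrow> y m = b \<Longrightarrow> (\<And>i. i < m \<Longrightarrow> y i < y (Suc i)) \<Longrightarrow>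
        (\<Sum>i<m. \<bar>F (y (Suc i)) - F (y i)\<bar>) \<le> V"
    and x: "x 0 = a" "x N = b" "\<And>j. j < N \<Longrightarrow> x j < x (Suc j)"
    and N: "0 < N"
    and B: "\<And>k. k \<le> N \<Longrightarrow> \<bar>\<Sum>j<k. (-1) ^ j * (x (Suc j) - x j)\<bar> \<le> B"
  shows "\<bar>\<Sum>j<N. (-1) ^ j * integral {x j..x (Suc j)} F\<bar> \<le> B * (\<bar>F b\<bar> + V)"
proof -
  have mono: "x i \<le> x j" if "i \<le> j" "j \<le> N" for i j
    using that
  proof (induction rule: dec_induct)
    case (step n)
    then show ?case using x(3)[of n] by simp
  qed simp
  have "\<exists>e. x j < e \<and> e < x (Suc j) \<and> integral {x j..x (Suc j)} F = (x (Suc j) - x j) * F e"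
    if j: "j < N" for j
  proof -
    have "{x j..x (Suc j)} \<subseteq> {a..b}" using mono[of 0 j] mono[of "Suc j" N] j x(1,2) by auto
    then show ?thesis
      using integral_mean_value[OF x(3)[OF j] continuous_on_subset[OF cont]] by metis
  qed
  then obtain \<eta> where \<eta>: "\<And>j. j < N \<Longrightarrow> x j < \<eta> j" "\<And>j. j < N \<Longrightarrow> \<eta> j < x (Suc j)"
      "\<And>j. j < N \<Longrightarrow> integral {x j..x (Suc j)} F = (x (Suc j) - x j) * F (\<eta> j)"
    by metis
  obtain M where M: "N = Suc M" using N gr0_implies_Suc by blast
  have \<eta>M: "\<eta> M < b" using \<eta>(2)[of M] M x(2) by simp
  \<comment> \<open>The points \<open>\<eta> j\<close>, completed by the end points to a partition of \<open>{a..b}\<close>.\<close>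
  define y where "y i = (if i = 0 then a else if i \<le> N then \<eta> (i - 1) else b)" for i
  have "y i < y (Suc i)" if "i < Suc N" for i
  proof -
    from that have "i < N \<or> i = N" by auto
    then consider "i = 0" | k where "i = Suc k" "Suc k < N" | "i = N"
      by (cases i) blast+
    then show ?thesis
    proof cases
      case 1
      then show ?thesis using \<eta>(1)[of 0] x(1) N by (simp add: y_def)
    next
      case (2 k)
      then show ?thesis using \<eta>(2)[of k] \<eta>(1)[of "Suc k"] by (simp add: y_def)
    next
      case 3
      then show ?thesis using \<eta>M M by (simp add: y_def)
    qed
  qed
  then have "(\<Sum>i<Suc N. \<bar>F (y (Suc i)) - F (y i)\<bar>) \<le> V"
    by (intro V) (auto simp: y_def)
  moreover have "(\<Sum>i<Suc N. \<bar>F (y (Suc i)) - F (y i)\<bar>) =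
      \<bar>F (\<eta> 0) - F a\<bar> + (\<Sum>j<M. \<bar>F (\<eta> (Suc j)) - F (\<eta> j)\<bar>) + \<bar>F b - F (\<eta> M)\<bar>"
    unfolding M sum.lessThan_Suc_shift[of _ "Suc M"] sum.lessThan_Suc[of _ M]
    by (simp add: y_def M)
  ultimately have var: "\<bar>F (\<eta> M)\<bar> + (\<Sum>j<M. \<bar>F (\<eta> (Suc j)) - F (\<eta> j)\<bar>) \<le> \<bar>F b\<bar> + V"
    by linarith
  have nonneg: "0 \<le> B" using B[of 0] by simp
  have eq: "(\<Sum>j<N. (-1) ^ j * integral {x j..x (Suc j)} F)
      = (\<Sum>j<Suc M. (-1) ^ j * (x (Suc j) - x j) * F (\<eta> j))"
    unfolding M[symmetric] by (intro sum.cong) (auto simp: \<eta>(3))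
  have "\<bar>\<Sum>j<Suc M. (-1) ^ j * (x (Suc j) - x j) * F (\<eta> j)\<bar>
      \<le> B * (\<bar>F (\<eta> M)\<bar> + (\<Sum>j<M. \<bar>F (\<eta> (Suc j)) - F (\<eta> j)\<bar>))"
    using B M by (intro abs_abel_sum_le) auto
  also have "\<dots> \<le> B * (\<bar>F b\<bar> + V)" by (rule mult_left_mono[OF var nonneg])
  finally show ?thesis unfolding eq .
qed

theorem corollary1:
  fixes F :: "real \<Rightarrow> real"
  assumes "continuous_on {1/2..1} F"
    and "bounded_variation_on F (1/2) 1"
  shows "(\<lambda>n. \<Sum>k = 2 ^ (n - 1)..2 ^ n - 1.
            (-1) ^ k * integral {sb_elem k n..sb_elem (k + 1) n} F)
         \<in> O(\<lambda>n. 1 / real n)"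
proof -
  obtain V where V: "\<And>m y. y 0 = 1/2 \<Longrightarrow> y m = 1 \<Longrightarrow> (\<And>i. i < m \<Longrightarrow> y i < y (Suc i)) \<Longrightarrow>
      (\<Sum>i<m. \<bar>F (y (Suc i)) - F (y i)\<bar>) \<le> V"
    using assms(2) unfolding bounded_variation_on_def by blast
  have "\<bar>\<Sum>k = 2 ^ (n - 1)..2 ^ n - 1. (-1) ^ k * integral {sb_elem k n..sb_elem (k + 1) n} F\<bar>
      \<le> \<bar>\<bar>F 1\<bar> + V\<bar> * \<bar>1 / real n\<bar>" if n: "2 \<le> n" for n
  proof -
    define p where "p = n - 2"
    define N :: nat where "N = 2 ^ Suc p"
    have np: "n = Suc (Suc p)" using n by (simp add: p_def)
    define x where "x j = sb_elem (N + j) n" for j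
    have diff: "x (Suc j) - x j = 1 / (stern (Suc p) 2 1 j * stern (Suc p) 2 1 (Suc j))"
      if "j < N" for j
      using sb_elem_upper_half[of j "Suc p"] that unfolding x_def N_def np by simp
    have "\<bar>\<Sum>j<k. (-1) ^ j * (x (Suc j) - x j)\<bar> \<le> 1 / (real n + 1)" if "k \<le> N" for k
    proof -
      have "(\<Sum>j<k. (-1) ^ j * (x (Suc j) - x j)) = alt_sum (Suc p) 2 1 k"
        unfolding alt_sum_def using that diff by (intro sum.cong) auto
      moreover have "end_len (Suc p) 1 2 = 1 / (real n + 1)"
        by (simp add: end_len_def np)
      ultimately show ?thesis
        using abs_alt_sum_le[of 1 2 k p] that unfolding N_def by simp
    qed
    moreover have "x j < x (Suc j)" if "j < N" for j
    proof -
      have "0 < x (Suc j) - x j" unfolding diff[OF that] by (simp add: stern_pos del: stern.simps)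
      then show ?thesis by simp
    qed
    moreover have "x 0 = 1/2" "x N = 1"
      using stern_split(2)[of 0 "Suc p" "1::real" 1] stern_split(2)[of 0 "Suc p" "0::real" 1]
        stern_last[of "Suc (Suc p)" "1::real" 1] stern_last[of "Suc (Suc p)" "0::real" 1]
      by (simp_all add: x_def N_def np sb_elem_eq sb_rat_eq mult_2 del: stern.simps stern_last)
    ultimately have "\<bar>\<Sum>j<N. (-1) ^ j * integral {x j..x (Suc j)} F\<bar> \<le> 1 / (real n + 1) * (\<bar>F 1\<bar> + V)"
      by (intro abs_alternating_integral_le[OF assms(1) V]) (auto simp: N_def)
    also have "\<dots> \<le> 1 / real n * \<bar>\<bar>F 1\<bar> + V\<bar>"
      using n by (intro order_trans[OF mult_left_mono[OF abs_ge_self] mult_right_mono]) (auto simp: frac_le)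
    also have "(\<Sum>j<N. (-1) ^ j * integral {x j..x (Suc j)} F)
        = (\<Sum>k = 2 ^ (n - 1)..2 ^ n - 1. (-1) ^ k * integral {sb_elem k n..sb_elem (k + 1) n} F)"
    proof -
      have "{2 ^ (n - 1)..2 ^ n - 1} = (\<lambda>j. N + j) ` {..<N}"
      proof -
        have eqs: "2 ^ (n - 1) = N" "2 ^ n = N + N" and "0 < N" by (simp_all add: N_def np)
        then have "{2 ^ (n - 1)..2 ^ n - 1} = {N..<N + N}" unfolding eqs by auto
        then show ?thesis by (simp add: lessThan_atLeast0)
      qed
      \<comment> \<open>The signs at \<open>N + j\<close> and \<open>j\<close> agree.\<close>
      moreover have "even N" by (simp add: N_def)
      ultimately show ?thesis
        by (simp add: sum.reindex x_def power_add)
    qed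
    finally show ?thesis by (simp add: mult.commute)
  qed
  then show ?thesis
    unfolding real_norm_def[symmetric]
    by (intro bigoI eventually_sequentiallyI)
qed

end
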